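(* Let $\{r_n\}_{n\ge1}$ be a nonnegative stochastic process adapted to a filtration $\{\mathcal F_n\}$, with $\sup_k|r_k|<+\infty$ almost surely, and let $\{\theta_n\}$ be a sequence with $\theta_n\in[c,d]\subset[0,1)$ for all $n\ge1$. Suppose that $$\mathbb E[r_{n+2}\mid\mathcal F_{n+1}]\le(1+\theta_n)r_{n+1}-\theta_nr_n,\qquad n\ge1.$$ Then $r_n$ converges almost surely to some finite random variable $r_\infty$.
   Context: All random variables are real-valued and live on a common probability space; the sequence $\{\theta_n\}$ is deterministic; inequalities between random variables hold almost surely. *)

theory Defs
  imports "HOL-Probability.Probability"
begin

text \<open>
  The conditional expectation of a nonnegative random variable is taken in \<open>[0, \<infinity>]\<close>, via
  \<^const>\<open>nn_cond_exp\<close>, so that no integrability is presupposed. Note that \<^const>\<open>real_cond_exp\<close>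
  takes the value 0 where the conditional expectation of a nonnegative variable is infinite, so
  it should not be used in an upper bound for variables that need not be integrable.
  For integrable nonnegative variables the two agree:
\<close>

lemma (in prob_space) nn_cond_exp_eq_real_cond_exp:
  fixes f :: "'a \<Rightarrow> real"
  assumes F: "subalgebra M F" and f: "integrable M f" and nonneg: "AE \<omega> in M. 0 \<le> f \<omega>"
  shows "AE \<omega> in M. enn2ereal (nn_cond_exp M F (\<lambda>\<omega>. ennreal (f \<omega>)) \<omega>)
                    = ereal (real_cond_exp M F f \<omega>)"
proof -
  interpret finite_measure_subalgebra M F
    by unfold_locales (rule F)
  have [measurable]: "f \<in> borel_measurable M" using f by simp
  have "(\<integral>\<^sup>+\<omega>. nn_cond_exp M F (\<lambda>\<omega>. ennreal (f \<omega>)) \<omega> \<partial>M) = (\<integral>\<^sup>+\<omega>. ennreal (f \<omega>) \<partial>M)"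
    using nn_cond_exp_intg[of "\<lambda>_. 1" "\<lambda>\<omega>. ennreal (f \<omega>)"] by simp
  also have "\<dots> < \<infinity>"
    using f nonneg by (simp add: nn_integral_eq_integral)
  finally have fin: "AE \<omega> in M. nn_cond_exp M F (\<lambda>\<omega>. ennreal (f \<omega>)) \<omega> \<noteq> \<infinity>"
    by (intro nn_integral_PInf_AE) auto
  have zero: "AE \<omega> in M. nn_cond_exp M F (\<lambda>\<omega>. ennreal (- f \<omega>)) \<omega> = nn_cond_exp M F (\<lambda>\<omega>. 0) \<omega>"
    by (rule nn_cond_exp_cong) (use nonneg in \<open>auto simp: ennreal_neg\<close>)
  have zero': "AE \<omega> in M. 0 = nn_cond_exp M F (\<lambda>\<omega>. 0) \<omega>"
    by (rule nn_cond_exp_charact) auto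
  show ?thesis
    using fin zero zero'
  proof eventually_elim
    case (elim \<omega>)
    then have "nn_cond_exp M F (\<lambda>\<omega>. ennreal (- f \<omega>)) \<omega> = 0" by simp
    with elim(1) show ?case
      unfolding real_cond_exp_def
      by (cases "nn_cond_exp M F (\<lambda>\<omega>. ennreal (f \<omega>)) \<omega>") auto
  qed
qed

end

theory Submission
  imports Defs
begin

text \<open>
  Put \<open>a\<^sub>n = \<theta>\<^sub>n + \<theta>\<^sub>n \<theta>\<^sub>n\<^sub>+\<^sub>1 + \<theta>\<^sub>n \<theta>\<^sub>n\<^sub>+\<^sub>1 \<theta>\<^sub>n\<^sub>+\<^sub>2 + \<dots>\<close>, so that \<open>a\<^sub>n = \<theta>\<^sub>n (1 + a\<^sub>n\<^sub>+\<^sub>1)\<close> and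
  \<open>0 \<le> a\<^sub>n \<le> d / (1 - d)\<close>. Then \<open>Y\<^sub>n = (1 + a\<^sub>n) r\<^sub>n\<^sub>+\<^sub>1 - a\<^sub>n r\<^sub>n\<close> satisfies the supermartingale
  inequality, and it is bounded below by \<open>- K d / (1 - d)\<close> as long as \<open>r\<^sub>n \<le> K\<close>. Hence
  \<open>Y\<^sub>n + K d / (1 - d)\<close>, killed once \<open>r\<close> has exceeded \<open>K\<close>, is a nonnegative supermartingale and
  converges. As \<open>sup r\<^sub>k\<close> is finite, \<open>Y\<^sub>n\<close> converges almost surely, and so does \<open>r\<^sub>n\<close>, because
  \<open>r\<^sub>n\<^sub>+\<^sub>1\<close> is the average of \<open>Y\<^sub>n\<close> and \<open>r\<^sub>n\<close> in which \<open>r\<^sub>n\<close> has weight \<open>a\<^sub>n / (1 + a\<^sub>n) \<le> d < 1\<close>.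

  The convergence of a nonnegative supermartingale \<open>X\<close> is shown multiplicatively: a gambler who
  reinvests everything in \<open>1 + X\<close> during each upcrossing of \<open>[a, b]\<close> multiplies the wealth by at
  least \<open>(1 + b) / (1 + a)\<close> each time, while the expected wealth does not increase.
\<close>

subsection \<open>Upcrossings of a real sequence\<close>

text \<open>The flag at time \<open>n\<close> depends only on \<open>x 0, ..., x n\<close>, so it
  can serve as the decision whether to bet on the step from \<open>n\<close> to
  \<open>Suc n\<close>.\<close>

primrec in_upcrossing :: "real \<Rightarrow> real \<Rightarrow> (nat \<Rightarrow> real) \<Rightarrow> nat \<Rightarrow> bool" where
  "in_upcrossing a b x 0 \<longleftrightarrow> x 0 < a"
| "in_upcrossing a b x (Suc n) \<longleftrightarrow> (if in_upcrossing a b x n then x (Suc n) \<le> b else x (Suc n) < a)"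

primrec upcrossings :: "real \<Rightarrow> real \<Rightarrow> (nat \<Rightarrow> real) \<Rightarrow> nat \<Rightarrow> nat" where
  "upcrossings a b x 0 = 0"
| "upcrossings a b x (Suc n) =
    upcrossings a b x n + (if in_upcrossing a b x n \<and> b < x (Suc n) then 1 else 0)"

text \<open>Self-financing trading in an asset of price \<open>1 + x\<close>, held exactly while the
  flag is up. The shift by 1 keeps the price positive for \<open>x \<ge> 0\<close>, so the division
  is harmless.\<close>

primrec wealth :: "real \<Rightarrow> real \<Rightarrow> (nat \<Rightarrow> real) \<Rightarrow> nat \<Rightarrow> real" where
  "wealth a b x 0 = 1"
| "wealth a b x (Suc n) =
    (if in_upcrossing a b x n then wealth a b x n / (1 + x n) * (1 + x (Suc n)) else wealth a b x n)"

lemma in_upcrossing_le: "a < b \<Longrightarrow> in_upcrossing a b x n \<Longrightarrow> x n \<le> b"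
  by (cases n) (auto split: if_splits)

lemma in_upcrossingI: "a < b \<Longrightarrow> x n < a \<Longrightarrow> in_upcrossing a b x n"
  by (cases n) auto

lemma mono_upcrossings: "mono (upcrossings a b x)"
  by (simp add: mono_iff_le_Suc)

text \<open>The flag is lowered only by completing an upcrossing, and that raises the counter, which
  never decreases.\<close>

lemma in_upcrossing_persists:
  assumes "m \<le> n" "in_upcrossing a b x m" "upcrossings a b x n = upcrossings a b x m"
  shows "in_upcrossing a b x n"
  using assms
proof (induction n rule: dec_induct)
  case base
  then show ?case by simp
next
  case (step n)
  have "upcrossings a b x m \<le> upcrossings a b x n" "upcrossings a b x n \<le> upcrossings a b x (Suc n)"
    using step.hyps by (auto intro!: monoD[OF mono_upcrossings])
  then have "upcrossings a b x n = upcrossings a b x m"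
    using step.prems by linarith
  with step show ?case by (auto split: if_splits)
qed

lemma upcrossings_unbounded:
  assumes "a < b" and low: "\<exists>\<^sub>F n in sequentially. x n < a" and high: "\<exists>\<^sub>F n in sequentially. b < x n"
  shows "\<exists>n. k \<le> upcrossings a b x n"
proof (induction k)
  case 0
  then show ?case by simp
next
  case (Suc k)
  then obtain n where n: "k \<le> upcrossings a b x n" by blast
  obtain m where m: "n \<le> m" "x m < a"
    using low by (auto simp: frequently_sequentially)
  obtain l where l: "m \<le> l" "b < x l"
    using high by (auto simp: frequently_sequentially)
  \<comment> \<open>Otherwise the flag, up at \<open>m\<close>, would still be up at
    \<open>l\<close>, forcing \<open>x l \<le> b\<close>.\<close>
  have "upcrossings a b x l \<noteq> upcrossings a b x m"
    using in_upcrossing_persists[OF l(1), of a b x] in_upcrossingI[of a b x m] m(2) \<open>a < b\<close>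
      in_upcrossing_le[OF \<open>a < b\<close>, of x l] l(2) by force
  then have "upcrossings a b x m < upcrossings a b x l"
    using monoD[OF mono_upcrossings l(1), of a b x] by linarith
  with n monoD[OF mono_upcrossings m(1), of a b x] show ?case
    by (intro exI[of _ l]) linarith
qed

text \<open>Each completed round buys below \<open>1 + a\<close> and sells above
  \<open>1 + b\<close>. The second factor values a position still open, bought below
  \<open>1 + a\<close> and now priced \<open>1 + x n\<close>; the induction needs it.\<close>

lemma wealth_lower_bound:
  assumes "0 \<le> a" "a < b" and nonneg: "\<And>n. 0 \<le> x n"
  shows "((1 + b) / (1 + a)) ^ upcrossings a b x n *
    (if in_upcrossing a b x n then (1 + x n) / (1 + a) else 1) \<le> wealth a b x n"
proof (induction n)
  case 0
  then show ?case using assms by simp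
next
  case (Suc n)
  define q where "q = ((1 + b) / (1 + a)) ^ upcrossings a b x n"
  have q: "0 \<le> q" using assms by (simp add: q_def)
  have pos: "0 < 1 + x k" for k using nonneg[of k] by linarith
  show ?case
  proof (cases "in_upcrossing a b x n")
    case True
    then have "q * (1 + x n) / (1 + a) \<le> wealth a b x n"
      using Suc by (simp add: q_def)
    then have "q * (1 + x n) / (1 + a) / (1 + x n) * (1 + x (Suc n)) \<le>
        wealth a b x n / (1 + x n) * (1 + x (Suc n))"
      by (intro mult_right_mono divide_right_mono less_imp_le[OF pos])
    also have "\<dots> = wealth a b x (Suc n)"
      using True by simp
    finally have "q * (1 + x n) / (1 + a) / (1 + x n) * (1 + x (Suc n)) \<le> wealth a b x (Suc n)" .
    then have *: "q * ((1 + x (Suc n)) / (1 + a)) \<le> wealth a b x (Suc n)"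
      using pos[of n] by simp
    show ?thesis
    proof (cases "x (Suc n) \<le> b")
      case True
      then show ?thesis
        using * \<open>in_upcrossing a b x n\<close> by (simp add: q_def)
    next
      case False
      then have "q * ((1 + b) / (1 + a)) \<le> q * ((1 + x (Suc n)) / (1 + a))"
        using q \<open>0 \<le> a\<close> by (intro mult_left_mono divide_right_mono) auto
      with * False \<open>in_upcrossing a b x n\<close> show ?thesis
        by (simp add: q_def mult.commute del: wealth.simps)
    qed
  next
    case False
    \<comment> \<open>If a position opens at \<open>Suc n\<close>, the required bound gets the
      factor \<open>(1 + x (Suc n)) / (1 + a)\<close>, which only weakens it.\<close>
    have "(1 + x (Suc n)) / (1 + a) \<le> 1" if "x (Suc n) < a"
      using that \<open>0 \<le> a\<close> by simp
    then have "q * (1 + x (Suc n)) / (1 + a) \<le> q" if "x (Suc n) < a"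
      using mult_left_mono[OF _ q] that by fastforce
    with False Suc show ?thesis
      by (fastforce simp: q_def)
  qed
qed

text \<open>An open position costs at most the factor \<open>1 / (1 + a)\<close>, because
  \<open>x n \<ge> 0\<close>.\<close>

lemma upcrossings_le_wealth:
  assumes "0 \<le> a" "a < b" and nonneg: "\<And>n. 0 \<le> x n"
  shows "((1 + b) / (1 + a)) ^ upcrossings a b x n \<le> (1 + a) * wealth a b x n"
proof -
  define q where "q = ((1 + b) / (1 + a)) ^ upcrossings a b x n"
  have q: "0 \<le> q" using assms by (simp add: q_def)
  have "1 / (1 + a) \<le> (if in_upcrossing a b x n then (1 + x n) / (1 + a) else 1)"
    using nonneg[of n] \<open>0 \<le> a\<close> by (auto intro!: divide_right_mono)
  then have "q * (1 / (1 + a)) \<le> q * (if in_upcrossing a b x n then (1 + x n) / (1 + a) else 1)"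
    using q by (rule mult_left_mono)
  also have "\<dots> \<le> wealth a b x n"
    unfolding q_def by (rule wealth_lower_bound[OF assms])
  finally show ?thesis
    using \<open>0 \<le> a\<close> by (fold q_def) (simp add: field_simps)
qed

lemma wealth_nonneg: "(\<And>n. 0 \<le> x n) \<Longrightarrow> 0 \<le> wealth a b x n"
  by (induction n) (auto intro!: mult_nonneg_nonneg divide_nonneg_nonneg add_nonneg_nonneg)

text \<open>A gap between liminf and limsup would contain two rationals crossed infinitely often;
  finiteness of the liminf rules out divergence to infinity.\<close>

lemma convergent_if_no_crossing:
  fixes x :: "nat \<Rightarrow> real"
  assumes nonneg: "\<And>n. 0 \<le> x n" and fin: "liminf (\<lambda>n. ennreal (x n)) < \<infinity>"
    and no_crossing: "\<And>a b. a \<in> \<rat> \<Longrightarrow> b \<in> \<rat> \<Longrightarrow> 0 \<le> a \<Longrightarrow> a < b \<Longrightarrow>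
      \<not> ((\<exists>\<^sub>F n in sequentially. x n < a) \<and> (\<exists>\<^sub>F n in sequentially. b < x n))"
  shows "convergent x"
proof -
  define l where "l = liminf (\<lambda>n. ennreal (x n))"
  define u where "u = limsup (\<lambda>n. ennreal (x n))"
  have "l \<le> u"
    unfolding l_def u_def by (rule Liminf_le_Limsup) simp
  moreover have "\<not> l < u"
  proof
    assume "l < u"
    then obtain s where s: "l < s" "s < u" using dense by blast
    then obtain t where t: "s < t" "t < u" using dense by blast
    obtain s' t' where st: "0 \<le> s'" "0 \<le> t'" "s = ennreal s'" "t = ennreal t'"
      using s t by (cases s; cases t) auto
    then have "s' < t'" using t by (simp add: ennreal_less_iff)
    obtain a where a: "a \<in> \<rat>" "s' < a" "a < t'" using Rats_dense_in_real[OF \<open>s' < t'\<close>] by blast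
    obtain b where b: "b \<in> \<rat>" "a < b" "b < t'" using Rats_dense_in_real[OF \<open>a < t'\<close>] by blast
    have "\<exists>\<^sub>F n in sequentially. x n < a"
    proof (rule ccontr)
      assume "\<not> ?thesis"
      then have "\<forall>\<^sub>F n in sequentially. ennreal a \<le> ennreal (x n)"
        by (auto simp: frequently_def not_less elim: eventually_mono intro: ennreal_leI)
      then have "ennreal a \<le> l"
        unfolding l_def by (rule Liminf_bounded)
      with s(1) st a(2) show False
        by (metis ennreal_leI leD less_imp_le order.strict_trans1)
    qed
    moreover have "\<exists>\<^sub>F n in sequentially. b < x n"
    proof (rule ccontr)
      assume "\<not> ?thesis"
      then have "\<forall>\<^sub>F n in sequentially. ennreal (x n) \<le> ennreal b"
        by (auto simp: frequently_def not_less elim: eventually_mono intro: ennreal_leI)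
      then have "u \<le> ennreal b"
        unfolding u_def by (rule Limsup_bounded)
      with t(2) st b(3) show False
        by (metis ennreal_leI leD less_imp_le order.strict_trans1)
    qed
    ultimately show False
      using no_crossing[of a b] a b st by auto
  qed
  ultimately have "l = u" by simp
  then have lim: "(\<lambda>n. ennreal (x n)) \<longlonglongrightarrow> l"
    by (intro Liminf_eq_Limsup) (auto simp: l_def u_def)
  obtain l' where l': "0 \<le> l'" "l = ennreal l'"
    using fin by (cases l) (auto simp: l_def)
  then have "x \<longlonglongrightarrow> l'"
    using lim nonneg by (simp add: tendsto_ennreal_iff)
  then show ?thesis by (rule convergentI)
qed

subsection \<open>Convergence of nonnegative supermartingales\<close>

text \<open>
  The supermartingale inequality is tested against nonnegative \<open>F\<^sub>n\<close>-measurable functions, so that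
  no integrability is needed.
\<close>

locale nonneg_supermartingale = prob_space M + filtration "space M" F
  for M :: "'a measure" and F :: "nat \<Rightarrow> 'a measure" +
  fixes X :: "nat \<Rightarrow> 'a \<Rightarrow> real"
  assumes subalgebra_F: "\<And>n. subalgebra M (F n)"
    and adapted [measurable]: "\<And>n. X n \<in> borel_measurable (F n)"
    and nonneg: "\<And>n \<omega>. 0 \<le> X n \<omega>"
    and decreasing: "\<And>n f. f \<in> borel_measurable (F n) \<Longrightarrow>
      (\<integral>\<^sup>+\<omega>. f \<omega> * ennreal (X (Suc n) \<omega>) \<partial>M) \<le> (\<integral>\<^sup>+\<omega>. f \<omega> * ennreal (X n \<omega>) \<partial>M)"
begin

lemma subalgebra_Suc: "subalgebra (F (Suc n)) (F n)"
  using sets_F_mono[of n "Suc n"] by (simp add: subalgebra_def space_F)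

lemma measurable_Suc: "f \<in> measurable (F n) N \<Longrightarrow> f \<in> measurable (F (Suc n)) N"
  by (rule measurable_from_subalg[OF subalgebra_Suc])

lemma measurable_M: "f \<in> measurable (F n) N \<Longrightarrow> f \<in> measurable M N"
  by (rule measurable_from_subalg[OF subalgebra_F])

lemma X_measurable_M [measurable]: "X n \<in> borel_measurable M"
  by (rule measurable_M[OF adapted])

lemma measurable_in_upcrossing [measurable]:
  "(\<lambda>\<omega>. in_upcrossing a b (\<lambda>n. X n \<omega>) n) \<in> measurable (F n) (count_space UNIV)"
proof (induction n)
  case (Suc n)
  note measurable_Suc[OF Suc, measurable]
  show ?case by simp
qed simp

lemma measurable_upcrossings [measurable]:
  "(\<lambda>\<omega>. upcrossings a b (\<lambda>n. X n \<omega>) n) \<in> measurable (F n) (count_space UNIV)"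
proof (induction n)
  case (Suc n)
  note measurable_Suc[OF Suc, measurable]
  note measurable_Suc[OF measurable_in_upcrossing[of a b n], measurable]
  show ?case by simp
qed simp

lemma measurable_wealth [measurable]:
  "(\<lambda>\<omega>. wealth a b (\<lambda>n. X n \<omega>) n) \<in> borel_measurable (F n)"
proof (induction n)
  case (Suc n)
  note measurable_Suc[OF Suc, measurable]
  note measurable_Suc[OF measurable_in_upcrossing[of a b n], measurable]
  note measurable_Suc[OF adapted[of n], measurable]
  show ?case by simp
qed simp

lemma nn_integral_wealth: "(\<integral>\<^sup>+\<omega>. ennreal (wealth a b (\<lambda>n. X n \<omega>) n) \<partial>M) \<le> 1"
proof (induction n)
  case 0
  then show ?case by (simp add: emeasure_space_1)
next
  case (Suc n)
  define W where "W \<omega> = wealth a b (\<lambda>n. X n \<omega>) n" for \<omega>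
  define H where "H \<omega> \<longleftrightarrow> in_upcrossing a b (\<lambda>n. X n \<omega>) n" for \<omega>
  \<comment> \<open>\<open>f\<close> is the number of units held and \<open>g\<close> the part of
    the wealth not multiplied by \<open>X\<close>. Both are known at time \<open>n\<close>, and the
    wealth at times \<open>n\<close> and \<open>Suc n\<close> is \<open>f * X k + g\<close> for
    \<open>k = n\<close> and \<open>k = Suc n\<close>, so \<open>f\<close> is the right test
    function for \<open>decreasing\<close>.\<close>
  define f where "f \<omega> = (if H \<omega> then W \<omega> / (1 + X n \<omega>) else 0)" for \<omega>
  define g where "g \<omega> = f \<omega> + (if H \<omega> then 0 else W \<omega>)" for \<omega>
  have [measurable]: "f \<in> borel_measurable (F n)" "g \<in> borel_measurable (F n)"
    unfolding f_def g_def W_def H_def by measurable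
  have [measurable]: "f \<in> borel_measurable M" "g \<in> borel_measurable M"
    by (rule measurable_M[of _ n], measurable)+
  have W: "0 \<le> W \<omega>" for \<omega>
    unfolding W_def by (rule wealth_nonneg) (rule nonneg)
  have f: "0 \<le> f \<omega>" and g: "0 \<le> g \<omega>" for \<omega>
    using W[of \<omega>] nonneg[of n \<omega>] by (auto simp: f_def g_def)
  have split: "ennreal (f \<omega> * X k \<omega> + g \<omega>) = ennreal (f \<omega>) * ennreal (X k \<omega>) + ennreal (g \<omega>)"
    for k \<omega>
    using f g nonneg by (simp add: ennreal_plus ennreal_mult)
  have next_wealth: "wealth a b (\<lambda>n. X n \<omega>) (Suc n) = f \<omega> * X (Suc n) \<omega> + g \<omega>" for \<omega>
    by (simp add: f_def g_def W_def H_def distrib_left)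
  have this_wealth: "W \<omega> = f \<omega> * X n \<omega> + g \<omega>" for \<omega>
  proof -
    have "1 + X n \<omega> \<noteq> 0" using nonneg[of n \<omega>] by linarith
    then have "W \<omega> / (1 + X n \<omega>) * X n \<omega> + W \<omega> / (1 + X n \<omega>) = W \<omega>"
      by (simp add: divide_simps) (simp add: algebra_simps)
    then show ?thesis by (simp add: f_def g_def)
  qed
  have "(\<integral>\<^sup>+\<omega>. ennreal (wealth a b (\<lambda>n. X n \<omega>) (Suc n)) \<partial>M) =
      (\<integral>\<^sup>+\<omega>. ennreal (f \<omega>) * ennreal (X (Suc n) \<omega>) \<partial>M) + (\<integral>\<^sup>+\<omega>. ennreal (g \<omega>) \<partial>M)"
    unfolding next_wealth split by (rule nn_integral_add) measurable
  also have "\<dots> \<le> (\<integral>\<^sup>+\<omega>. ennreal (f \<omega>) * ennreal (X n \<omega>) \<partial>M) + (\<integral>\<^sup>+\<omega>. ennreal (g \<omega>) \<partial>M)"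
    by (intro add_right_mono decreasing) measurable
  also have "\<dots> = (\<integral>\<^sup>+\<omega>. ennreal (W \<omega>) \<partial>M)"
    unfolding this_wealth split by (rule nn_integral_add[symmetric]) measurable
  finally show ?case
    using Suc unfolding W_def by order
qed

text \<open>The expectation of \<open>q ^ upcrossings\<close> is at most \<open>1 + a\<close> at all
  times, so by monotone convergence its supremum is almost surely finite. As \<open>q > 1\<close>,
  the number of upcrossings is then bounded.\<close>

lemma AE_no_crossing:
  assumes "0 \<le> a" "a < b"
  shows "AE \<omega> in M. \<not> ((\<exists>\<^sub>F n in sequentially. X n \<omega> < a) \<and> (\<exists>\<^sub>F n in sequentially. b < X n \<omega>))"
proof -
  define q where "q = (1 + b) / (1 + a)"
  have q: "1 < q" using assms by (simp add: q_def)
  define G where "G n \<omega> = ennreal (q ^ upcrossings a b (\<lambda>n. X n \<omega>) n)" for n \<omega>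
  have [measurable]: "(\<lambda>\<omega>. upcrossings a b (\<lambda>n. X n \<omega>) n) \<in> measurable M (count_space UNIV)" for n
    by (rule measurable_M[OF measurable_upcrossings])
  have [measurable]: "(\<lambda>\<omega>. wealth a b (\<lambda>n. X n \<omega>) n) \<in> borel_measurable M" for n
    by (rule measurable_M[OF measurable_wealth])
  have [measurable]: "G n \<in> borel_measurable M" for n
    unfolding G_def by measurable
  have "incseq G"
    unfolding G_def
    by (intro incseq_SucI le_funI ennreal_leI power_increasing less_imp_le[OF q] monoD[OF mono_upcrossings]) simp
  then have "(\<integral>\<^sup>+\<omega>. (SUP n. G n \<omega>) \<partial>M) = (SUP n. \<integral>\<^sup>+\<omega>. G n \<omega> \<partial>M)"
    by (rule nn_integral_monotone_convergence_SUP) measurable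
  also have "\<dots> \<le> ennreal (1 + a)"
  proof (rule SUP_least)
    fix n
    have "(\<integral>\<^sup>+\<omega>. G n \<omega> \<partial>M) \<le> (\<integral>\<^sup>+\<omega>. ennreal (1 + a) * ennreal (wealth a b (\<lambda>n. X n \<omega>) n) \<partial>M)"
      unfolding G_def q_def using assms nonneg
      by (intro nn_integral_mono)
        (simp add: ennreal_mult[symmetric] wealth_nonneg upcrossings_le_wealth ennreal_leI del: ennreal_plus)
    also have "\<dots> = ennreal (1 + a) * (\<integral>\<^sup>+\<omega>. ennreal (wealth a b (\<lambda>n. X n \<omega>) n) \<partial>M)"
      by (rule nn_integral_cmult) measurable
    also have "\<dots> \<le> ennreal (1 + a) * 1"
      by (intro mult_left_mono nn_integral_wealth) simp
    finally show "(\<integral>\<^sup>+\<omega>. G n \<omega> \<partial>M) \<le> ennreal (1 + a)" by simp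
  qed
  finally have "(\<integral>\<^sup>+\<omega>. (SUP n. G n \<omega>) \<partial>M) \<noteq> \<infinity>"
    by (auto simp: top_unique)
  then have "AE \<omega> in M. (SUP n. G n \<omega>) \<noteq> \<infinity>"
    by (intro nn_integral_PInf_AE) measurable
  then show ?thesis
  proof eventually_elim
    case (elim \<omega>)
    show ?case
    proof
      assume *: "(\<exists>\<^sub>F n in sequentially. X n \<omega> < a) \<and> (\<exists>\<^sub>F n in sequentially. b < X n \<omega>)"
      obtain s where s: "(SUP n. G n \<omega>) = ennreal s"
        using elim by (cases "SUP n. G n \<omega>") auto
      obtain k where k: "s < q ^ k"
        using real_arch_pow[OF q] by blast
      obtain n where n: "k \<le> upcrossings a b (\<lambda>n. X n \<omega>) n"
        using upcrossings_unbounded[OF \<open>a < b\<close>, of "\<lambda>n. X n \<omega>"] * by blast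
      have "ennreal (q ^ k) \<le> G n \<omega>"
        unfolding G_def using n q by (intro ennreal_leI power_increasing) auto
      also have "\<dots> \<le> ennreal s"
        unfolding s[symmetric] by (rule SUP_upper) simp
      finally have "q ^ k \<le> s \<or> q ^ k \<le> 0"
        by (auto simp: ennreal_le_iff2)
      moreover have "0 < q ^ k" using q by simp
      ultimately show False using k by linarith
    qed
  qed
qed

text \<open>\<open>X 0\<close> need not be integrable, so Fatou's lemma is applied on each event
  \<open>X 0 \<le> N\<close>. Its indicator is known at time 0 and hence admissible as a test
  function at every time.\<close>

lemma AE_liminf_finite: "AE \<omega> in M. liminf (\<lambda>n. ennreal (X n \<omega>)) < \<infinity>"
proof -
  define h where "h N = (\<lambda>\<omega>. indicator {\<omega>. X 0 \<omega> \<le> real N} \<omega> :: ennreal)" for N :: nat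
  have "AE \<omega> in M. h N \<omega> * liminf (\<lambda>n. ennreal (X n \<omega>)) \<noteq> \<infinity>" for N
  proof -
    have h_meas: "h N \<in> borel_measurable (F n)" for n
    proof (induction n)
      case (Suc n)
      then show ?case by (rule measurable_Suc)
    qed (simp add: h_def)
    note measurable_M[OF h_meas[of 0], measurable]
    have bound: "(\<integral>\<^sup>+\<omega>. h N \<omega> * ennreal (X n \<omega>) \<partial>M) \<le> ennreal (real N)" for n
    proof (induction n)
      case 0
      have "(\<integral>\<^sup>+\<omega>. h N \<omega> * ennreal (X 0 \<omega>) \<partial>M) \<le> (\<integral>\<^sup>+\<omega>. ennreal (real N) \<partial>M)"
        by (intro nn_integral_mono) (auto simp: h_def indicator_def intro: ennreal_leI)
      then show ?case by (simp add: emeasure_space_1)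
    next
      case (Suc n)
      then show ?case using decreasing[OF h_meas, of n] by order
    qed
    have "(\<integral>\<^sup>+\<omega>. h N \<omega> * liminf (\<lambda>n. ennreal (X n \<omega>)) \<partial>M) \<le>
        (\<integral>\<^sup>+\<omega>. liminf (\<lambda>n. h N \<omega> * ennreal (X n \<omega>)) \<partial>M)"
      by (intro nn_integral_mono) (auto simp: h_def indicator_def)
    also have "\<dots> \<le> liminf (\<lambda>n. \<integral>\<^sup>+\<omega>. h N \<omega> * ennreal (X n \<omega>) \<partial>M)"
      by (rule nn_integral_liminf) measurable
    also have "\<dots> \<le> ennreal (real N)"
      using bound by (intro Liminf_le) auto
    finally show ?thesis
      by (intro nn_integral_PInf_AE) (auto simp: top_unique)
  qed
  then have "AE \<omega> in M. \<forall>N. h N \<omega> * liminf (\<lambda>n. ennreal (X n \<omega>)) \<noteq> \<infinity>"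
    by (simp add: AE_all_countable)
  then show ?thesis
  proof eventually_elim
    case (elim \<omega>)
    obtain N where "X 0 \<omega> \<le> real N" using real_arch_simple by blast
    with elim[rule_format, of N] show ?case
      by (simp add: h_def less_top[symmetric])
  qed
qed

theorem AE_convergent: "AE \<omega> in M. convergent (\<lambda>n. X n \<omega>)"
proof -
  \<comment> \<open>Rational endpoints leave only countably many exceptional null sets.\<close>
  have "AE \<omega> in M. \<forall>p\<in>{(a, b). a \<in> \<rat> \<and> b \<in> \<rat> \<and> 0 \<le> a \<and> a < b}.
    \<not> ((\<exists>\<^sub>F n in sequentially. X n \<omega> < fst p) \<and> (\<exists>\<^sub>F n in sequentially. snd p < X n \<omega>))"
  proof (rule AE_ball_countable[THEN iffD2])
    show "countable {(a :: real, b). a \<in> \<rat> \<and> b \<in> \<rat> \<and> 0 \<le> a \<and> a < b}"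
      by (rule countable_subset[of _ "\<rat> \<times> \<rat>"]) (auto intro: countable_rat)
  qed (use AE_no_crossing in auto)
  with AE_liminf_finite show ?thesis
    by eventually_elim (rule convergent_if_no_crossing, auto intro: nonneg)
qed

end

subsection \<open>Extrapolated sequences\<close>

lemma discounted_weights:
  fixes \<theta> :: "nat \<Rightarrow> real"
  assumes "0 \<le> d" "d < 1" and \<theta>: "\<And>n. 1 \<le> n \<Longrightarrow> 0 \<le> \<theta> n \<and> \<theta> n \<le> d"
  shows "\<exists>a. \<forall>n\<ge>1. 0 \<le> a n \<and> a n \<le> d / (1 - d) \<and> a n = \<theta> n * (1 + a (Suc n))"
proof -
  \<comment> \<open>The product has \<open>j + 1\<close> factors, hence the bound
    \<open>d * d ^ j\<close>; splitting off the term \<open>j = 0\<close> of the series gives the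
    recursion.\<close>
  define p where "p n j = (\<Prod>i\<le>j. \<theta> (n + i))" for n j
  have p: "0 \<le> p n j" "p n j \<le> d * d ^ j" if "1 \<le> n" for n j
  proof -
    show "0 \<le> p n j" unfolding p_def using \<theta> that by (intro prod_nonneg) auto
    have "p n j \<le> (\<Prod>i\<le>j. d)"
      unfolding p_def using \<theta> that by (intro prod_mono) auto
    then show "p n j \<le> d * d ^ j" by simp
  qed
  have geom: "(\<lambda>j. d * d ^ j) sums (d / (1 - d))"
    using sums_mult[OF geometric_sums[of d], of d] assms by simp
  have p_summable: "summable (p n)" if "1 \<le> n" for n
    using p[OF that] by (intro summable_comparison_test'[OF sums_summable[OF geom]]) auto
  have rec: "(\<Sum>j. p n j) = \<theta> n * (1 + (\<Sum>j. p (Suc n) j))" if "1 \<le> n" for n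
  proof -
    have "p n (Suc j) = \<theta> n * p (Suc n) j" for j
      unfolding p_def by (subst prod.atMost_Suc_shift) simp
    then have "(\<Sum>j. p n (Suc j)) = \<theta> n * (\<Sum>j. p (Suc n) j)"
      using suminf_mult[OF p_summable[of "Suc n"], of "\<theta> n"] by simp
    moreover have "p n 0 = \<theta> n" by (simp add: p_def)
    ultimately show ?thesis
      using suminf_split_head[OF p_summable[OF that]] by (simp add: algebra_simps)
  qed
  show ?thesis
  proof (intro exI[of _ "\<lambda>n. \<Sum>j. p n j"] allI impI conjI)
    fix n :: nat
    assume n: "1 \<le> n"
    show "0 \<le> (\<Sum>j. p n j)"
      using p[OF n] by (intro suminf_nonneg p_summable n) auto
    show "(\<Sum>j. p n j) \<le> d / (1 - d)"
      using suminf_le[OF p(2)[OF n] p_summable[OF n] sums_summable[OF geom]] sums_unique[OF geom]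
      by simp
    show "(\<Sum>j. p n j) = \<theta> n * (1 + (\<Sum>j. p (Suc n) j))"
      by (rule rec[OF n])
  qed
qed

lemma tendsto_zero_of_contraction:
  fixes e u :: "nat \<Rightarrow> real"
  assumes "0 \<le> d" "d < 1" and u: "u \<longlonglongrightarrow> 0" and step: "\<And>n. \<bar>e (Suc n)\<bar> \<le> \<bar>u n\<bar> + d * \<bar>e n\<bar>"
  shows "e \<longlonglongrightarrow> 0"
proof (rule LIMSEQ_I)
  fix \<epsilon> :: real
  assume "0 < \<epsilon>"
  \<comment> \<open>This threshold makes \<open>\<epsilon> / 2\<close> the fixed point of
    \<open>t \<mapsto> \<epsilon> / 2 * (1 - d) + d * t\<close>, so the bound \<open>decay\<close>
    reproduces itself.\<close>
  then have "0 < \<epsilon> / 2 * (1 - d)" using \<open>d < 1\<close> by simp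
  from LIMSEQ_D[OF u this] obtain N where N: "\<And>n. N \<le> n \<Longrightarrow> \<bar>u n\<bar> < \<epsilon> / 2 * (1 - d)"
    by auto
  have decay: "\<bar>e (N + k)\<bar> \<le> \<epsilon> / 2 + d ^ k * \<bar>e N\<bar>" for k
  proof (induction k)
    case 0
    then show ?case using \<open>0 < \<epsilon>\<close> by simp
  next
    case (Suc k)
    have "\<bar>e (N + Suc k)\<bar> \<le> \<bar>u (N + k)\<bar> + d * \<bar>e (N + k)\<bar>"
      using step[of "N + k"] by simp
    also have "\<dots> \<le> \<epsilon> / 2 * (1 - d) + d * (\<epsilon> / 2 + d ^ k * \<bar>e N\<bar>)"
      using N[of "N + k"] Suc \<open>0 \<le> d\<close> by (intro add_mono mult_left_mono) auto
    finally show ?case by (simp add: field_simps)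
  qed
  have "(\<lambda>k. d ^ k * \<bar>e N\<bar>) \<longlonglongrightarrow> 0"
    using assms by (intro tendsto_mult_left_zero LIMSEQ_power_zero) simp
  from LIMSEQ_D[OF this, of "\<epsilon> / 2"] \<open>0 < \<epsilon>\<close>
  obtain L where L: "\<And>k. L \<le> k \<Longrightarrow> d ^ k * \<bar>e N\<bar> < \<epsilon> / 2"
    using \<open>0 \<le> d\<close> by auto
  have "norm (e n - 0) < \<epsilon>" if "N + L \<le> n" for n
    using decay[of "n - N"] L[of "n - N"] that by force
  then show "\<exists>n0. \<forall>n\<ge>n0. norm (e n - 0) < \<epsilon>" by blast
qed

lemma convergent_of_extrapolation:
  fixes x a :: "nat \<Rightarrow> real"
  assumes "0 \<le> d" "d < 1" and a: "\<And>n. 0 \<le> a n" "\<And>n. a n \<le> d / (1 - d)"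
    and conv: "convergent (\<lambda>n. (1 + a n) * x (Suc n) - a n * x n)"
  shows "convergent x"
proof -
  obtain y where y: "(\<lambda>n. (1 + a n) * x (Suc n) - a n * x n) \<longlonglongrightarrow> y"
    using conv by (auto simp: convergent_def)
  define u where "u n = (1 + a n) * x (Suc n) - a n * x n - y" for n
  have "(\<lambda>n. x n - y) \<longlonglongrightarrow> 0"
  proof (rule tendsto_zero_of_contraction[OF assms(1,2)])
    show "u \<longlonglongrightarrow> 0"
      using y unfolding u_def by (rule LIM_zero)
    fix n
    have a1: "0 < 1 + a n" using a(1)[of n] by linarith
    \<comment> \<open>\<open>t / (1 + t)\<close> increases in \<open>t\<close> and equals
      \<open>d\<close> at \<open>t = d / (1 - d)\<close>.\<close>
    have "a n / (1 + a n) \<le> d"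
      using a(2)[of n] a1 \<open>d < 1\<close> by (simp add: field_simps)
    moreover have "\<bar>u n\<bar> / (1 + a n) \<le> \<bar>u n\<bar>"
      using a(1)[of n] a1 by (simp add: divide_le_eq mult_left_le algebra_simps)
    moreover have "x (Suc n) - y = u n / (1 + a n) + a n / (1 + a n) * (x n - y)"
    proof -
      have "x (Suc n) - y = (u n + a n * (x n - y)) / (1 + a n)"
        using a1 by (simp add: u_def eq_divide_eq algebra_simps)
      then show ?thesis by (simp add: add_divide_distrib)
    qed
    ultimately show "\<bar>x (Suc n) - y\<bar> \<le> \<bar>u n\<bar> + d * \<bar>x n - y\<bar>"
      using a1 a(1)[of n] mult_right_mono[of "a n / (1 + a n)" d "\<bar>x n - y\<bar>"]
        abs_triangle_ineq[of "u n / (1 + a n)" "a n / (1 + a n) * (x n - y)"]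
      by (simp add: abs_mult)
  qed
  then show ?thesis by (intro convergentI) (rule LIM_zero_cancel)
qed

section \<open>Almost sure convergence of \<open>r\<close> through the killed extrapolation\<close>

theorem lemma6:
  fixes M :: "'a measure"
    and F :: "nat \<Rightarrow> 'a measure"
    and r :: "nat \<Rightarrow> 'a \<Rightarrow> real"
    and \<theta> :: "nat \<Rightarrow> real"
    and c d :: real
  assumes "prob_space M"
    and "filtration (space M) F"
    and "\<And>n. subalgebra M (F n)"
    and adapted: "\<And>n. 1 \<le> n \<Longrightarrow> r n \<in> borel_measurable (F n)"
    and nonneg: "\<And>n. 1 \<le> n \<Longrightarrow> AE \<omega> in M. 0 \<le> r n \<omega>"
    and sup_finite: "AE \<omega> in M. (SUP k\<in>{1..}. ereal \<bar>r k \<omega>\<bar>) < \<infinity>"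
    and "{c..d} \<subseteq> {0..<1}"
    and "\<And>n. 1 \<le> n \<Longrightarrow> \<theta> n \<in> {c..d}"
    and cond_exp_le: "\<And>n. 1 \<le> n \<Longrightarrow>
      AE \<omega> in M. enn2ereal (nn_cond_exp M (F (n + 1)) (\<lambda>\<omega>. ennreal (r (n + 2) \<omega>)) \<omega>)
                  \<le> ereal ((1 + \<theta> n) * r (n + 1) \<omega> - \<theta> n * r n \<omega>)"
  shows "\<exists>r_inf :: 'a \<Rightarrow> real. r_inf \<in> borel_measurable M \<and>
      (AE \<omega> in M. (\<lambda>n. r n \<omega>) \<longlonglongrightarrow> r_inf \<omega>)"
proof -
  interpret prob_space M by fact
  interpret filtration "space M" F by fact
  have d: "0 \<le> d" "d < 1" and \<theta>: "\<And>n. 1 \<le> n \<Longrightarrow> 0 \<le> \<theta> n \<and> \<theta> n \<le> d"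
  proof -
    \<comment> \<open>The value \<open>\<theta> 1\<close> shows that the interval is nonempty; only
      then does the inclusion bound \<open>c\<close> and \<open>d\<close>.\<close>
    have \<theta>_cd: "c \<le> \<theta> n \<and> \<theta> n \<le> d" if "1 \<le> n" for n using assms(8)[OF that] by simp
    from \<theta>_cd[of 1] have "c \<le> d" by simp
    with assms(7) have "0 \<le> c" "d < 1" by auto
    with \<open>c \<le> d\<close> show "0 \<le> d" "d < 1" by simp_all
    show "0 \<le> \<theta> n \<and> \<theta> n \<le> d" if "1 \<le> n" for n
      using \<theta>_cd[OF that] \<open>0 \<le> c\<close> by simp
  qed
  obtain a where weights:
      "\<forall>n\<ge>1. 0 \<le> a n \<and> a n \<le> d / (1 - d) \<and> a n = \<theta> n * (1 + a (Suc n))"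
    using discounted_weights[OF d \<theta>] ..
  have a: "0 \<le> a n" "a n \<le> d / (1 - d)" and a_rec: "a n = \<theta> n * (1 + a (Suc n))" if "1 \<le> n" for n
    using weights[rule_format, OF that] by simp_all
  \<comment> \<open>Indices now start at 0, and truncation makes nonnegativity hold everywhere, as
    the supermartingale locale demands. Since \<open>s k\<close> stands for
    \<open>r (Suc k)\<close>, it is known at time \<open>n\<close> once
    \<open>k < n\<close>.\<close>
  define s where "s n \<omega> = max 0 (r (Suc n) \<omega>)" for n \<omega>
  have s_nonneg: "0 \<le> s n \<omega>" for n \<omega> by (simp add: s_def)
  have s_eq: "AE \<omega> in M. \<forall>n. s n \<omega> = r (Suc n) \<omega>"
    using nonneg by (auto simp: s_def AE_all_countable max_def)
  have s_meas: "s k \<in> borel_measurable (F n)" if "k < n" for k n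
  proof -
    have "subalgebra (F n) (F (Suc k))"
      using sets_F_mono[of "Suc k" n] that by (simp add: subalgebra_def space_F)
    then have [measurable]: "r (Suc k) \<in> borel_measurable (F n)"
      using adapted by (rule measurable_from_subalg) simp
    show ?thesis unfolding s_def by measurable
  qed
  define Y where "Y n \<omega> = (1 + a (Suc n)) * s (Suc n) \<omega> - a (Suc n) * s n \<omega>" for n \<omega>
  have Y_convergent: "AE \<omega> in M. (\<forall>n. s n \<omega> \<le> real K) \<longrightarrow> convergent (\<lambda>n. Y n \<omega>)" for K :: nat
  proof -
    define C where "C = d / (1 - d) * real K"
    \<comment> \<open>The bound stops at \<open>s n\<close>, the subtracted term of
      \<open>Y n\<close>; \<open>s (Suc n)\<close> enters with a positive coefficient. Thus
      \<open>G (Suc n)\<close> is already \<open>F (n + 2)\<close>-measurable, like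
      \<open>Z n\<close>, and killing is decided before \<open>Z (Suc n)\<close> is seen.\<close>
    define G where "G n \<omega> \<longleftrightarrow> (\<forall>k\<le>n. s k \<omega> \<le> real K)" for n \<omega>
    define Z where "Z n \<omega> = (if G n \<omega> then Y n \<omega> + C else 0)" for n \<omega>
    have C: "a (Suc n) * s n \<omega> \<le> C" if "G n \<omega>" for n \<omega>
      unfolding C_def using a[of "Suc n"] that s_nonneg d by (intro mult_mono) (auto simp: G_def)
    have Z_nonneg: "0 \<le> Z n \<omega>" for n \<omega>
    proof -
      have "0 \<le> (1 + a (Suc n)) * s (Suc n) \<omega>"
        using a(1)[of "Suc n"] s_nonneg by simp
      then show ?thesis
        using C[of n \<omega>] by (auto simp: Z_def Y_def)
    qed
    have G_meas: "G k \<in> measurable (F n) (count_space UNIV)" if "k < n" for k n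
    proof -
      have [measurable]: "s j \<in> borel_measurable (F n)" if "j \<le> k" for j
        using s_meas that \<open>k < n\<close> by simp
      show ?thesis
        unfolding G_def by measurable
    qed
    have "nonneg_supermartingale M (\<lambda>n. F (n + 2)) Z"
    proof unfold_locales
      fix n
      note s_meas[of n "n + 2", measurable] s_meas[of "Suc n" "n + 2", measurable]
        G_meas[of n "n + 2", measurable] G_meas[of "Suc n" "n + 2", measurable]
      show "subalgebra M (F (n + 2))" by fact
      show "Z n \<in> borel_measurable (F (n + 2))"
        unfolding Z_def Y_def by measurable
      fix f :: "'a \<Rightarrow> ennreal"
      assume [measurable]: "f \<in> borel_measurable (F (n + 2))"
      interpret finite_measure_subalgebra M "F (n + 2)"
        by unfold_locales fact
      \<comment> \<open>The product \<open>f * Z (Suc n)\<close> is split as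
        \<open>g * s (n + 2) + h\<close> with \<open>g\<close> and \<open>h\<close> known at time
        \<open>n + 2\<close>, so that only \<open>s (n + 2)\<close> is conditioned. On
        \<open>G (Suc n)\<close> the constant \<open>C\<close> keeps the remainder in
        \<open>h\<close> nonnegative.\<close>
      define g where "g \<omega> = (if G (Suc n) \<omega> then f \<omega> * ennreal (1 + a (n + 2)) else 0)" for \<omega>
      define h where "h \<omega> = (if G (Suc n) \<omega> then f \<omega> * ennreal (C - a (n + 2) * s (Suc n) \<omega>) else 0)" for \<omega>
      have gF [measurable]: "g \<in> borel_measurable (F (n + 2))" and hF: "h \<in> borel_measurable (F (n + 2))"
        unfolding g_def h_def by measurable
      have [measurable]: "g \<in> borel_measurable M" "h \<in> borel_measurable M"
        using gF hF subalg measurable_from_subalg by blast+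
      have [measurable]: "s (n + 2) \<in> borel_measurable M"
        by (rule measurable_from_subalg[OF assms(3) s_meas[of "n + 2" "n + 3"]]) simp
      have "(\<integral>\<^sup>+\<omega>. f \<omega> * ennreal (Z (Suc n) \<omega>) \<partial>M) = (\<integral>\<^sup>+\<omega>. g \<omega> * ennreal (s (n + 2) \<omega>) + h \<omega> \<partial>M)"
      proof (rule nn_integral_cong)
        fix \<omega>
        show "f \<omega> * ennreal (Z (Suc n) \<omega>) = g \<omega> * ennreal (s (n + 2) \<omega>) + h \<omega>"
        proof (cases "G (Suc n) \<omega>")
          case True
          then have "Z (Suc n) \<omega> = (1 + a (n + 2)) * s (n + 2) \<omega> + (C - a (n + 2) * s (Suc n) \<omega>)"
            by (simp add: Z_def Y_def)
          then have "ennreal (Z (Suc n) \<omega>) = ennreal (1 + a (n + 2)) * ennreal (s (n + 2) \<omega>) +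
              ennreal (C - a (n + 2) * s (Suc n) \<omega>)"
            using C[OF True] a(1)[of "n + 2"] s_nonneg[of "n + 2" \<omega>]
            by (simp add: ennreal_plus[of "x * y" for x y] ennreal_mult del: ennreal_plus)
          then show ?thesis
            using True by (simp add: g_def h_def distrib_left mult.assoc del: ennreal_plus)
        qed (simp add: g_def h_def Z_def)
      qed
      also have "\<dots> = (\<integral>\<^sup>+\<omega>. g \<omega> * ennreal (s (n + 2) \<omega>) \<partial>M) + (\<integral>\<^sup>+\<omega>. h \<omega> \<partial>M)"
        by (rule nn_integral_add) measurable
      also have "(\<integral>\<^sup>+\<omega>. g \<omega> * ennreal (s (n + 2) \<omega>) \<partial>M) =
          (\<integral>\<^sup>+\<omega>. g \<omega> * nn_cond_exp M (F (n + 2)) (\<lambda>\<omega>. ennreal (s (n + 2) \<omega>)) \<omega> \<partial>M)"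
        by (rule nn_cond_exp_intg[symmetric]) measurable
      also have "\<dots> + (\<integral>\<^sup>+\<omega>. h \<omega> \<partial>M) =
          (\<integral>\<^sup>+\<omega>. g \<omega> * nn_cond_exp M (F (n + 2)) (\<lambda>\<omega>. ennreal (s (n + 2) \<omega>)) \<omega> + h \<omega> \<partial>M)"
        by (rule nn_integral_add[symmetric]) measurable
      also have "\<dots> \<le> (\<integral>\<^sup>+\<omega>. f \<omega> * ennreal (Z n \<omega>) \<partial>M)"
      proof (rule nn_integral_mono_AE)
        \<comment> \<open>\<open>ennreal\<close> sends negative reals to 0, so the truncation
          changes nothing here, at any point.\<close>
        have "(\<lambda>\<omega>. ennreal (s (n + 2) \<omega>)) = (\<lambda>\<omega>. ennreal (r (n + 3) \<omega>))"
          by (auto simp: s_def max_def ennreal_neg numeral_3_eq_3)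
        with cond_exp_le[of "n + 1"]
        have "AE \<omega> in M. enn2ereal (nn_cond_exp M (F (n + 2)) (\<lambda>\<omega>. ennreal (s (n + 2) \<omega>)) \<omega>)
            \<le> ereal ((1 + \<theta> (Suc n)) * r (n + 2) \<omega> - \<theta> (Suc n) * r (Suc n) \<omega>)"
          by (simp add: numeral_3_eq_3)
        with s_eq show "AE \<omega> in M. g \<omega> * nn_cond_exp M (F (n + 2)) (\<lambda>\<omega>. ennreal (s (n + 2) \<omega>)) \<omega> + h \<omega>
            \<le> f \<omega> * ennreal (Z n \<omega>)"
        proof eventually_elim
          case (elim \<omega>)
          \<comment> \<open>Off \<open>G (Suc n)\<close> the left side is 0; on it
            \<open>G n\<close> holds as well, so \<open>Z n\<close> is not yet killed.\<close>
          show ?case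
          proof (cases "G (Suc n) \<omega>")
            case True
            define E where "E = nn_cond_exp M (F (n + 2)) (\<lambda>\<omega>. ennreal (s (n + 2) \<omega>)) \<omega>"
            define b where "b = (1 + \<theta> (Suc n)) * s (Suc n) \<omega> - \<theta> (Suc n) * s n \<omega>"
            have E: "enn2ereal E \<le> ereal b"
              using elim by (simp add: E_def b_def)
            have b: "0 \<le> b"
              using order_trans[OF enn2ereal_nonneg E] by simp
            have "E \<le> ennreal b"
              using E b by (simp add: less_eq_ennreal.rep_eq)
            then have "g \<omega> * E + h \<omega> \<le> g \<omega> * ennreal b + h \<omega>"
              by (intro add_right_mono mult_left_mono) auto
            also have "\<dots> = f \<omega> * ennreal ((1 + a (n + 2)) * b + (C - a (n + 2) * s (Suc n) \<omega>))"
              using True C[OF True] a[of "n + 2"] b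
              by (subst ennreal_plus) (auto simp: g_def h_def ennreal_mult distrib_left mult.assoc simp del: ennreal_plus)
            \<comment> \<open>The recursion
              \<open>\<theta> (Suc n) * (1 + a (n + 2)) = a (Suc n)\<close> turns the coefficients
              of \<open>s (Suc n)\<close> and \<open>s n\<close> into those of
              \<open>Y n\<close>.\<close>
            also have "(1 + a (n + 2)) * b + (C - a (n + 2) * s (Suc n) \<omega>) = Y n \<omega> + C"
              using a_rec[of "Suc n"] by (simp add: Y_def b_def algebra_simps)
            also have "\<dots> = Z n \<omega>"
              using True by (simp add: Z_def G_def)
            finally show ?thesis unfolding E_def .
          qed (simp add: g_def h_def)
        qed
      qed
      finally show "(\<integral>\<^sup>+\<omega>. f \<omega> * ennreal (Z (Suc n) \<omega>) \<partial>M) \<le> (\<integral>\<^sup>+\<omega>. f \<omega> * ennreal (Z n \<omega>) \<partial>M)" .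
    next
      show "space (F (n + 2)) = space M" for n by (rule space_F)
      show "sets (F (i + 2)) \<subseteq> sets (F (j + 2))" if "i \<le> j" for i j
        by (rule sets_F_mono) (use that in simp)
    qed (rule Z_nonneg)
    then have "AE \<omega> in M. convergent (\<lambda>n. Z n \<omega>)"
      by (rule nonneg_supermartingale.AE_convergent)
    then show ?thesis
    proof eventually_elim
      case (elim \<omega>)
      show ?case
      proof
        assume "\<forall>n. s n \<omega> \<le> real K"
        then have "convergent (\<lambda>n. Y n \<omega> + C)"
          using elim by (simp add: Z_def G_def)
        then show "convergent (\<lambda>n. Y n \<omega>)"
          by (simp add: convergent_add_const_right_iff)
      qed
    qed
  qed
  \<comment> \<open>Countably many levels \<open>K\<close> suffice: almost every path lies below one
    of them and is never killed at that level.\<close>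
  have "AE \<omega> in M. \<forall>K::nat. (\<forall>n. s n \<omega> \<le> real K) \<longrightarrow> convergent (\<lambda>n. Y n \<omega>)"
    unfolding AE_all_countable by (rule allI, rule Y_convergent)
  with sup_finite s_eq have conv: "AE \<omega> in M. convergent (\<lambda>n. r (Suc n) \<omega>)"
  proof eventually_elim
    case (elim \<omega>)
    obtain K :: nat where K: "(SUP k\<in>{1..}. ereal \<bar>r k \<omega>\<bar>) \<le> ereal (real K)"
      using elim(1) less_PInf_Ex_of_nat by (auto intro: less_imp_le)
    have "s n \<omega> \<le> real K" for n
    proof -
      have "ereal \<bar>r (Suc n) \<omega>\<bar> \<le> ereal (real K)"
        by (rule order_trans[OF SUP_upper K]) simp
      then show ?thesis by (simp add: s_def)
    qed
    then have "convergent (\<lambda>n. Y n \<omega>)"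
      using elim(3) by blast
    then have Y_conv: "convergent (\<lambda>n. (1 + a (Suc n)) * s (Suc n) \<omega> - a (Suc n) * s n \<omega>)"
      by (simp only: Y_def)
    have "convergent (\<lambda>n. s n \<omega>)"
    proof (rule convergent_of_extrapolation[OF d _ _ Y_conv])
      show "0 \<le> a (Suc n)" "a (Suc n) \<le> d / (1 - d)" for n
        by (rule a, simp)+
    qed
    with elim(2) show ?case by simp
  qed
  show ?thesis
  proof (intro exI conjI)
    have [measurable]: "r (Suc n) \<in> borel_measurable M" for n
      by (rule measurable_from_subalg[OF assms(3) adapted]) simp
    \<comment> \<open>\<open>lim\<close> is total, so this witness is measurable on the whole space,
      also where the limit fails to exist. The shift avoids \<open>r 0\<close>, about which nothing
      is assumed.\<close>
    show "(\<lambda>\<omega>. lim (\<lambda>n. r (Suc n) \<omega>)) \<in> borel_measurable M"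
      by (rule borel_measurable_lim_metric) measurable
    show "AE \<omega> in M. (\<lambda>n. r n \<omega>) \<longlonglongrightarrow> lim (\<lambda>n. r (Suc n) \<omega>)"
      using conv
    proof eventually_elim
      case (elim \<omega>)
      then have "(\<lambda>n. r (Suc n) \<omega>) \<longlonglongrightarrow> lim (\<lambda>n. r (Suc n) \<omega>)"
        by (simp only: convergent_LIMSEQ_iff)
      then show ?case by (rule LIMSEQ_imp_Suc)
    qed
  qed
qed

end
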